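(* Let $X$ be a real Banach space and let $A, B:X\rightrightarrows X^*$ be monotone with $\operatorname{dom} A\cap\operatorname{dom} B\neq\varnothing$. Assume that $A+B$ is ultramaximally monotone. Suppose that one of the following conditions holds: (i) $A$ and $B$ are rectangular; (ii) $\operatorname{dom} A\subseteq\operatorname{dom} B$ and $B$ is rectangular. Then $$\operatorname{int}\operatorname{ran}(A+B)=\operatorname{int}\left[\operatorname{ran} A+\operatorname{ran} B\right]\quad\text{and}\quad\overline{\operatorname{ran} A+\operatorname{ran} B}=\overline{\operatorname{ran}(A+B)}.$$
   Context: $X$ is a real Banach space with dual $X^*$ and bidual $X^{**}$; $X$ is identified with its canonical image in $X^{**}$, and $\langle\cdot,\cdot\rangle$ denotes the duality pairing. For a set-valued operator $A:X\rightrightarrows X^*$, $\operatorname{gra}A=\{(x,x^* )\in X\times X^*\mid x^*\in Ax\}$, $\operatorname{dom}A=\{x\in X\mid Ax\neq\varnothing\}$, $\operatorname{ran}A=\bigcup_{x\in X}Ax$, and $(A+B)x=\{a^*+b^*\mid a^*\in Ax,\ b^*\in Bx\}$. $A$ is monotone if $\langle x-y,x^*-y^*\rangle\ge 0$ for all $(x,x^* ),(y,y^* )\in\operatorname{gra}A$. A monotone $A$ is ultramaximally monotone if it is maximally monotone with respect to $X^{**}\times X^*$: whenever $(x^{**},x^* )\in X^{**}\times X^*$ satisfies $\langle x^{**}-a,x^*-a^*\rangle\ge 0$ for all $(a,a^* )\in\operatorname{gra}A$, then $x^{**}\in X$ and $(x^{**},x^* )\in\operatorname{gra}A$. For $A$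 with $\operatorname{dom}A\neq\varnothing$, the Fitzpatrick function is $F_A(x,x^* )=\sup_{(a,a^* )\in\operatorname{gra}A}\big(\langle x,a^*\rangle+\langle a,x^*\rangle-\langle a,a^*\rangle\big)$ for $(x,x^* )\in X\times X^*$, and $\operatorname{dom}F_A$ is the set of points where it is finite. An operator $A$ with $\operatorname{dom}A\neq\varnothing$ is rectangular if $\operatorname{dom}A\times\operatorname{ran}A\subseteq\operatorname{dom}F_A$. $\operatorname{int}$ and the overline denote interior and closure in the norm topology of $X^*$. *)

theory Defs
  imports "HOL-Analysis.Analysis" "HOL-Library.Set_Algebras"
begin

type_synonym 'a dual = "'a \<Rightarrow>\<^sub>L real"

type_synonym 'a setop = "'a \<Rightarrow> 'a dual set"

definition gra :: "'a::real_normed_vector setop \<Rightarrow> ('a \<times> 'a dual) set" where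
  "gra A = {(x, x'). x' \<in> A x}"

definition op_dom :: "'a::real_normed_vector setop \<Rightarrow> 'a set" where
  "op_dom A = {x. A x \<noteq> {}}"

definition op_ran :: "'a::real_normed_vector setop \<Rightarrow> 'a dual set" where
  "op_ran A = (\<Union>x. A x)"

definition op_sum :: "'a::real_normed_vector setop \<Rightarrow> 'a setop \<Rightarrow> 'a setop" where
  "op_sum A B = (\<lambda>x. {a' + b' | a' b'. a' \<in> A x \<and> b' \<in> B x})"

definition monotone_op :: "'a::real_normed_vector setop \<Rightarrow> bool" where
  "monotone_op A \<longleftrightarrow>
    (\<forall>(x, x') \<in> gra A. \<forall>(y, y') \<in> gra A. 0 \<le> blinfun_apply (x' - y') (x - y))"

definition canonical_embedding :: "'a::real_normed_vector \<Rightarrow> 'a dual dual" where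
  "canonical_embedding x = Blinfun (\<lambda>f. blinfun_apply f x)"

lemma canonical_embedding_apply [simp]:
  "blinfun_apply (canonical_embedding x) f = blinfun_apply f x"
  by (simp add: canonical_embedding_def bounded_linear_Blinfun_apply blinfun.bounded_linear_left)

text \<open>The identification of a space with its canonical image in its bidual is made explicit:
  membership of a bidual element in the space means being the image of some \<open>x\<close>.\<close>

definition ultramaximally_monotone :: "'a::real_normed_vector setop \<Rightarrow> bool" where
  "ultramaximally_monotone A \<longleftrightarrow> monotone_op A \<and>
    (\<forall>x'' x'.
      (\<forall>(a, a') \<in> gra A. 0 \<le> blinfun_apply (x'' - canonical_embedding a) (x' - a')) \<longrightarrow>
      (\<exists>x. x'' = canonical_embedding x \<and> (x, x') \<in> gra A))"

definition fitzpatrick :: "'a::real_normed_vector setop \<Rightarrow> 'a \<Rightarrow> 'a dual \<Rightarrow> ereal" where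
  "fitzpatrick A x x' = (SUP (a, a') \<in> gra A.
     ereal (blinfun_apply a' x + blinfun_apply x' a - blinfun_apply a' a))"

definition fitzpatrick_dom :: "'a::real_normed_vector setop \<Rightarrow> ('a \<times> 'a dual) set" where
  "fitzpatrick_dom A = {(x, x'). \<bar>fitzpatrick A x x'\<bar> \<noteq> \<infinity>}"

definition rectangular :: "'a::real_normed_vector setop \<Rightarrow> bool" where
  "rectangular A \<longleftrightarrow> op_dom A \<noteq> {} \<and> op_dom A \<times> op_ran A \<subseteq> fitzpatrick_dom A"

end

theory Submission
  imports Defs
begin

text \<open>Either rectangularity condition puts \<open>ran A + ran B\<close> into the projection \<open>D\<close> of
  \<open>dom F\<^sub>C\<close> onto the dual, where \<open>C = A + B\<close>; so it suffices that
  \<open>D \<subseteq> closure (ran C)\<close> and \<open>interior D \<subseteq> ran C\<close>. Since \<open>X\<^sup>*\<^sup>* \<times> X\<^sup>*\<close> is the dual of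
  \<open>X\<^sup>* \<times> X\<close>, the Hahn-Banach theorem produces points of \<open>X\<^sup>*\<^sup>* \<times> X\<^sup>*\<close> that are monotonically
  related to the graph of \<open>C\<close>, and these lie in the graph by ultramaximality.

  For the closure, separating the convexified coupling on the graph from \<open>- \<parallel>\<cdot>\<parallel>\<^sup>2 / 2\<close> gives, for
  each \<open>w\<close> and each scale \<open>t > 0\<close>, a point \<open>(x, y)\<close> of the graph such that \<open>t (w - y)\<close> is a
  duality vector of \<open>x\<close>; if \<open>w \<in> D\<close>, then \<open>y\<close> tends to \<open>w\<close> as \<open>t\<close> grows. For the interior, let
  \<open>w = 0\<close> by translation. Baire's theorem makes the bounds on \<open>F\<^sub>C\<close> uniform near \<open>0\<close>, so that the
  convexified coupling dominates \<open>- R \<parallel>x'\<parallel>\<close>; the functional \<open>u\<close> separating the two yields a point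
  \<open>(u, 0)\<close> related to the graph.\<close>

section \<open>The Hahn-Banach theorem for cones\<close>

text \<open>Zorn's lemma is applied to cones, ordered by inclusion, rather than to partial functionals:
  a maximal cone contains \<open>(x, L x)\<close> and \<open>(- x, - L x)\<close> for every \<open>x\<close>, and is thus the epigraph
  of a linear functional \<open>L\<close>.\<close>

lemma hahn_banach_cone:
  fixes Q :: "('v::real_vector \<times> real) set"
  assumes add: "\<And>p q. p \<in> Q \<Longrightarrow> q \<in> Q \<Longrightarrow> p + q \<in> Q"
    and scale: "\<And>p t. p \<in> Q \<Longrightarrow> 0 < t \<Longrightarrow> t *\<^sub>R p \<in> Q"
    and total: "\<And>x. \<exists>r. (x, r) \<in> Q"
    and nonneg: "\<And>r. (0, r) \<in> Q \<Longrightarrow> 0 \<le> r"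
  obtains L where "linear L" "\<And>x r. (x, r) \<in> Q \<Longrightarrow> L x \<le> r"
proof -
  \<comment> \<open>The origin is inserted because \<open>Q\<close> is closed under positive
    multiples only and may miss it; \<open>L 0 = 0\<close> is later read off from it.\<close>
  define cone where "cone P \<longleftrightarrow> insert 0 Q \<subseteq> P \<and> (\<forall>p\<in>P. \<forall>q\<in>P. p + q \<in> P) \<and>
    (\<forall>p\<in>P. \<forall>t>0. t *\<^sub>R p \<in> P) \<and> (\<forall>r. (0, r) \<in> P \<longrightarrow> 0 \<le> r)" for P :: "('v \<times> real) set"
  have "cone (insert 0 Q)"
    using assms unfolding cone_def by (auto simp: zero_prod_def)
  have "\<exists>M\<in>{P. cone P}. \<forall>X\<in>{P. cone P}. M \<subseteq> X \<longrightarrow> X = M"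
  proof (rule subset_Zorn_nonempty)
    show "{P. cone P} \<noteq> {}"
      using \<open>cone (insert 0 Q)\<close> by blast
    fix \<C> :: "('v \<times> real) set set"
    assume ne: "\<C> \<noteq> {}" and chain: "subset.chain {P. cone P} \<C>"
    have cone: "cone P" if "P \<in> \<C>" for P
      using that chain by (auto simp: subset.chain_def)
    have "p + q \<in> \<Union>\<C>" if "p \<in> \<Union>\<C>" "q \<in> \<Union>\<C>" for p q
    proof -
      obtain P R where PR: "P \<in> \<C>" "R \<in> \<C>" "p \<in> P" "q \<in> R"
        using \<open>p \<in> \<Union>\<C>\<close> \<open>q \<in> \<Union>\<C>\<close> by blast
      then have "P \<subseteq> R \<or> R \<subseteq> P"
        using chain unfolding subset_chain_def by blast
      then show ?thesis
        using PR cone unfolding cone_def by blast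
    qed
    moreover have "insert 0 Q \<subseteq> \<Union>\<C>"
      using ne cone unfolding cone_def by blast
    moreover have "\<forall>p\<in>\<Union>\<C>. \<forall>t>0. t *\<^sub>R p \<in> \<Union>\<C>" "\<forall>r. (0, r) \<in> \<Union>\<C> \<longrightarrow> 0 \<le> r"
      using cone unfolding cone_def by blast+
    ultimately show "\<Union>\<C> \<in> {P. cone P}"
      unfolding cone_def by simp
  qed
  then obtain P where P: "cone P" and max: "\<And>X. cone X \<Longrightarrow> P \<subseteq> X \<Longrightarrow> X = P"
    by auto
  have addP: "p + q \<in> P" if "p \<in> P" "q \<in> P" for p q
    using P that unfolding cone_def by blast
  have addP2: "(x + y, r + s) \<in> P" if "(x, r) \<in> P" "(y, s) \<in> P" for x y r s
    using addP[OF that] by simp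
  have scaleP: "t *\<^sub>R p \<in> P" if "p \<in> P" "0 < t" for p t
    using P that unfolding cone_def by blast
  have nonnegP: "0 \<le> r" if "(0, r) \<in> P" for r
    using P that unfolding cone_def by blast
  have zeroP: "0 \<in> P" and QP: "Q \<subseteq> P"
    using P unfolding cone_def by blast+
  \<comment> \<open>By maximality it is enough that adding the ray through \<open>(x, s)\<close>
    creates no negative value over \<open>0\<close>. A new value there needs a point of
    \<open>P\<close> over a positive multiple of \<open>- x\<close>; after scaling, the hypothesis
    on \<open>s\<close> applies.\<close>
  have adjoin: "(x, s) \<in> P" if s: "\<And>\<rho>. (- x, \<rho>) \<in> P \<Longrightarrow> 0 \<le> \<rho> + s" for x s
  proof -
    define P' where "P' = {p + t *\<^sub>R (x, s) | p t. p \<in> P \<and> 0 \<le> t}"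
    have I: "p + t *\<^sub>R (x, s) \<in> P'" if "p \<in> P" "0 \<le> t" for p t
      using that unfolding P'_def by blast
    have sub: "P \<subseteq> P'"
      using I[of _ 0] by auto
    have "p + q \<in> P'" if pq: "p \<in> P'" "q \<in> P'" for p q
    proof -
      obtain p' t q' u where "p = p' + t *\<^sub>R (x, s)" "q = q' + u *\<^sub>R (x, s)"
        "p' \<in> P" "q' \<in> P" "0 \<le> t" "0 \<le> u"
        using pq unfolding P'_def by blast
      moreover from this have "p + q = (p' + q') + (t + u) *\<^sub>R (x, s)"
        by (simp add: algebra_simps)
      ultimately show ?thesis
        by (metis I addP add_nonneg_nonneg)
    qed
    moreover have "k *\<^sub>R p \<in> P'" if p: "p \<in> P'" and "0 < k" for p k
    proof -
      obtain p' t where "p = p' + t *\<^sub>R (x, s)" "p' \<in> P" "0 \<le> t"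
        using p unfolding P'_def by blast
      moreover from this have "k *\<^sub>R p = k *\<^sub>R p' + (k * t) *\<^sub>R (x, s)"
        by (simp add: algebra_simps)
      ultimately show ?thesis
        using I[OF scaleP] \<open>0 < k\<close> by simp
    qed
    moreover have "0 \<le> r" if r: "(0, r) \<in> P'" for r
    proof -
      obtain y \<rho> t where y: "(y, \<rho>) \<in> P" "0 \<le> t" "0 = y + t *\<^sub>R x" "r = \<rho> + t * s"
        using r unfolding P'_def by auto
      show ?thesis
      proof (cases "t = 0")
        case True
        then show ?thesis using y nonnegP by simp
      next
        case False
        then have "0 < t" using y by simp
        moreover have "y = - (t *\<^sub>R x)"
          using y(3) by (metis add_eq_0_iff2)
        ultimately have "inverse t *\<^sub>R (y, \<rho>) = (- x, \<rho> / t)"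
          by (simp add: divide_inverse_commute)
        then have "0 \<le> \<rho> / t + s"
          using s scaleP[OF y(1), of "inverse t"] \<open>0 < t\<close> by simp
        then show ?thesis
          using \<open>0 < t\<close> y(4) by (simp add: field_simps)
      qed
    qed
    ultimately have "cone P'"
      using sub zeroP QP unfolding cone_def by blast
    then have "P' = P" using max sub by blast
    then show ?thesis using I[OF zeroP, of 1] by simp
  qed
  have "\<exists>s. (x, s) \<in> P \<and> (- x, - s) \<in> P" for x
  proof -
    \<comment> \<open>\<open>- Inf I\<close> is the least value that \<open>adjoin\<close> admits
      over \<open>x\<close>; \<open>lower\<close> then makes its negative admissible over
      \<open>- x\<close>.\<close>
    define I where "I = {\<rho>. (- x, \<rho>) \<in> P}"
    have lower: "- \<rho> \<le> \<rho>'" if "(x, \<rho>) \<in> P" "\<rho>' \<in> I" for \<rho> \<rho>'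
      using nonnegP[of "\<rho> + \<rho>'"] addP2[OF that(1), of "- x" \<rho>'] that(2) by (simp add: I_def)
    obtain \<rho>0 where \<rho>0: "(x, \<rho>0) \<in> P" using total QP by blast
    have "I \<noteq> {}" using total[of "- x"] QP unfolding I_def by blast
    have bdd: "bdd_below I" using lower[OF \<rho>0] by (rule bdd_belowI)
    have "(x, - Inf I) \<in> P"
      by (rule adjoin) (use cInf_lower[OF _ bdd] in \<open>force simp: I_def\<close>)
    moreover have "(- x, - (- Inf I)) \<in> P"
    proof (rule adjoin)
      fix \<rho> assume "(- (- x), \<rho>) \<in> P"
      then have "- \<rho> \<le> Inf I" using lower \<open>I \<noteq> {}\<close> by (intro cInf_greatest) auto
      then show "0 \<le> \<rho> + - (- Inf I)" by simp
    qed
    ultimately show ?thesis by blast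
  qed
  then obtain L where L: "\<And>x. (x, L x) \<in> P" "\<And>x. (- x, - L x) \<in> P"
    by metis
  have le: "L x \<le> r" if "(x, r) \<in> P" for x r
    using nonnegP[of "r - L x"] addP2[OF that L(2)[of x]] by simp
  have eq: "L x = r" if "(x, r) \<in> P" "(- x, - r) \<in> P" for x r
    using le[OF that(1)] nonnegP[of "L x - r"] addP2[OF L(1)[of x] that(2)] by simp
  have "linear L"
  proof
    show "L (x + y) = L x + L y" for x y
      using addP2[OF L(1)[of x] L(1)[of y]] addP2[OF L(2)[of x] L(2)[of y]]
      by (intro eq) (simp_all add: algebra_simps)
    have pos: "L (t *\<^sub>R x) = t * L x" if "0 < t" for t x
      using scaleP[OF L(1)[of x] that] scaleP[OF L(2)[of x] that] by (intro eq) simp_all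
    have neg: "L (- x) = - L x" for x
      using L[of x] by (intro eq) simp_all
    show "L (t *\<^sub>R x) = t *\<^sub>R L x" for t x
    proof -
      consider "0 < t" | "t = 0" | "0 < - t" by linarith
      then show ?thesis
      proof cases
        case 2
        then show ?thesis using eq[of 0 0] zeroP by (simp add: zero_prod_def)
      next
        case 3
        then show ?thesis using pos[of "- t" x] neg[of "t *\<^sub>R x"] by simp
      qed (simp add: pos)
    qed
  qed
  then show ?thesis
    using that le QP by blast
qed

lemma linear_bounded_above_on_ball:
  fixes L :: "'v::real_normed_vector \<Rightarrow> real"
  assumes "linear L" and B: "\<And>x. norm x \<le> 1 \<Longrightarrow> L x \<le> B"
  shows "bounded_linear L"
proof -
  have "\<bar>L x\<bar> \<le> norm x * B" for x
  proof (cases "x = 0")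
    case False
    have "L (inverse (norm x) *\<^sub>R x) \<le> B" "L (inverse (norm x) *\<^sub>R (- x)) \<le> B"
      by (rule B, use False in simp)+
    then show ?thesis
      using False by (simp add: linear_cmul[OF assms(1)] linear_neg[OF assms(1)] field_simps abs_le_iff)
  qed (simp add: linear_0[OF assms(1)])
  then show ?thesis
    using assms(1) by (intro bounded_linear_intro[of L B]) (auto simp: linear_add linear_cmul)
qed

section \<open>The convexified coupling on the graph\<close>

text \<open>Homogenisation of the convex hull of the function that equals \<open>a' a\<close> on the graph:
  a tuple \<open>(l, x, x', r)\<close> with \<open>l = 1\<close> records a convex combination \<open>(x, x')\<close> of graph points
  together with the same combination \<open>r\<close> of the values \<open>a' a\<close>.\<close>

inductive graph_cone :: "('a::real_normed_vector \<times> 'a dual) set \<Rightarrow> real \<Rightarrow> 'a \<Rightarrow> 'a dual \<Rightarrow> real \<Rightarrow> bool"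
  for G where
  gen: "(a, a') \<in> G \<Longrightarrow> 0 < t \<Longrightarrow> graph_cone G t (t *\<^sub>R a) (t *\<^sub>R a') (t * blinfun_apply a' a)"
| add: "graph_cone G l x x' r \<Longrightarrow> graph_cone G m y y' s \<Longrightarrow>
    graph_cone G (l + m) (x + y) (x' + y') (r + s)"

lemma graph_cone_base: "(a, a') \<in> G \<Longrightarrow> graph_cone G 1 a a' (blinfun_apply a' a)"
  using graph_cone.gen[of a a' G 1] by simp

lemma graph_cone_pos: "graph_cone G l x x' r \<Longrightarrow> 0 < l"
  by (induction rule: graph_cone.induct) auto

lemma graph_cone_scale:
  "graph_cone G l x x' r \<Longrightarrow> 0 < k \<Longrightarrow> graph_cone G (k * l) (k *\<^sub>R x) (k *\<^sub>R x') (k * r)"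
proof (induction rule: graph_cone.induct)
  case (gen a a' t)
  then show ?case using graph_cone.gen[of a a' G "k * t"] by (simp add: mult.assoc)
next
  case (add l x x' r m y y' s)
  then show ?case using graph_cone.add by (simp add: distrib_left scaleR_add_right)
qed

text \<open>For two generators this is monotonicity multiplied by \<open>t * u\<close>. Both sides
  are additive in each tuple, so induction on one tuple and then the other covers all sums.\<close>

lemma graph_cone_mixed:
  assumes "monotone_op C" "graph_cone (gra C) l x x' r" "graph_cone (gra C) m y y' s"
  shows "blinfun_apply y' x + blinfun_apply x' y \<le> l * s + m * r"
  using assms(2)
proof (induction rule: graph_cone.induct)
  case (gen a a' t)
  show ?case
    using assms(3)
  proof (induction rule: graph_cone.induct)
    case (gen b b' u)
    have "0 \<le> blinfun_apply (a' - b') (a - b)"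
      using assms(1) \<open>(a, a') \<in> gra C\<close> gen(1) unfolding monotone_op_def by blast
    then have "0 \<le> (t * u) * blinfun_apply (a' - b') (a - b)"
      using \<open>0 < t\<close> gen(2) by simp
    then show ?case
      by (simp add: blinfun.bilinear_simps algebra_simps)
  next
    case (add m y y' s n z z' q)
    then show ?case by (simp add: blinfun.bilinear_simps algebra_simps)
  qed
next
  case (add l x x' r m y y' s)
  then show ?case by (simp add: blinfun.bilinear_simps algebra_simps)
qed

text \<open>The diagonal case: convexification keeps the coupling above the duality pairing. Both
  separations below rest on this.\<close>

lemma graph_cone_pairing_le:
  "monotone_op C \<Longrightarrow> graph_cone (gra C) l x x' r \<Longrightarrow> blinfun_apply x' x \<le> l * r"
  using graph_cone_mixed[of C l x x' r l x x' r] by simp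

section \<open>Quadratic minorants and negative duality points\<close>

text \<open>The conjugate of half the squared norm is half the squared dual norm. On the line
  through \<open>x\<close> the maximum is attained at the multiple \<open>t\<close> defined
  below.\<close>

lemma norm_le_of_affine_minorant:
  fixes v :: "'a::real_normed_vector dual"
  assumes "\<And>x. blinfun_apply v x - (norm x)\<^sup>2 / 2 \<le> N"
  shows "(norm v)\<^sup>2 / 2 \<le> N"
proof -
  have N: "0 \<le> N" using assms[of 0] by simp
  have "norm v \<le> sqrt (2 * N)"
  proof (rule norm_blinfun_bound)
    show "0 \<le> sqrt (2 * N)" using N by simp
    fix x
    show "norm (blinfun_apply v x) \<le> sqrt (2 * N) * norm x"
    proof (cases "x = 0")
      case False
      then have nx: "0 < (norm x)\<^sup>2" by simp
      define t where "t = blinfun_apply v x / (norm x)\<^sup>2"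
      have "t * blinfun_apply v x - t\<^sup>2 * (norm x)\<^sup>2 / 2 \<le> N"
        using assms[of "t *\<^sub>R x"] by (simp add: blinfun.bilinear_simps power_mult_distrib)
      moreover have "t * blinfun_apply v x = t\<^sup>2 * (norm x)\<^sup>2"
        using nx by (simp add: t_def power2_eq_square)
      ultimately have "t\<^sup>2 * (norm x)\<^sup>2 \<le> 2 * N" by linarith
      moreover have "t\<^sup>2 * (norm x)\<^sup>2 = (blinfun_apply v x)\<^sup>2 / (norm x)\<^sup>2"
        using nx by (simp add: t_def power2_eq_square)
      ultimately have "(blinfun_apply v x)\<^sup>2 \<le> 2 * N * (norm x)\<^sup>2"
        using nx by (simp add: pos_divide_le_eq)
      then have "sqrt ((blinfun_apply v x)\<^sup>2) \<le> sqrt (2 * N * (norm x)\<^sup>2)"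
        by (rule real_sqrt_le_mono)
      then show ?thesis by (simp add: real_sqrt_mult)
    qed simp
  qed
  then have "(norm v)\<^sup>2 \<le> (sqrt (2 * N))\<^sup>2" by (intro power_mono) auto
  then show ?thesis using N by simp
qed

lemma ultramaximally_monotone_gra_nonempty:
  assumes "ultramaximally_monotone C"
  shows "gra C \<noteq> {}"
proof
  assume "gra C = {}"
  then show False using assms unfolding ultramaximally_monotone_def by blast
qed


text \<open>Subadditivity of the perspective of the squared norm; for reals the gap is a square over
  a positive number.\<close>

lemma norm_sum_sq_div_le:
  fixes p q :: "'v::real_normed_vector"
  assumes "0 < l" "0 < m"
  shows "(norm (p + q))\<^sup>2 / (l + m) \<le> (norm p)\<^sup>2 / l + (norm q)\<^sup>2 / m"
proof -
  have *: "(a + b)\<^sup>2 / (l + m) \<le> a\<^sup>2 / l + b\<^sup>2 / m" for a b :: real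
  proof -
    have "a\<^sup>2 / l + b\<^sup>2 / m - (a + b)\<^sup>2 / (l + m) = (m * a - l * b)\<^sup>2 / (l * m * (l + m))"
      using assms by (simp add: divide_simps power2_eq_square) (simp add: algebra_simps)
    moreover have "0 \<le> (m * a - l * b)\<^sup>2 / (l * m * (l + m))"
      using assms by simp
    ultimately show ?thesis by linarith
  qed
  have "(norm (p + q))\<^sup>2 / (l + m) \<le> (norm p + norm q)\<^sup>2 / (l + m)"
    using assms by (intro divide_right_mono power_mono norm_triangle_ineq) auto
  then show ?thesis using *[of "norm p" "norm q"] by linarith
qed

text \<open>The convexified coupling lies above the pairing, hence above minus half the sum of the
  squared norms. A functional separating the two has components \<open>v\<close> and
  \<open>u\<close>, and conjugating the squared norms produces the constant.\<close>

lemma quadratic_minorant: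
  assumes mono: "monotone_op C" and ne: "gra C \<noteq> {}"
  obtains u :: "'a::real_normed_vector dual dual" and v :: "'a dual"
  where "\<And>a a'. (a, a') \<in> gra C \<Longrightarrow>
    blinfun_apply v a + blinfun_apply u a' + ((norm u)\<^sup>2 + (norm v)\<^sup>2) / 2 \<le> blinfun_apply a' a"
proof -
  \<comment> \<open>The epigraph of the infimal convolution of the convexified coupling, reflected,
    with half the squared norms. Dividing by \<open>l\<close> homogenises the squares and makes
    \<open>Q\<close> a cone.\<close>
  define Q where "Q = {((y, y'), s) | y y' s. \<exists>l x x' r. graph_cone (gra C) l x x' r \<and>
    r + (norm (x + y))\<^sup>2 / l / 2 + (norm (x' + y'))\<^sup>2 / l / 2 \<le> s}"
  have Q: "((y, y'), s) \<in> Q \<longleftrightarrow> (\<exists>l x x' r. graph_cone (gra C) l x x' r \<and>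
    r + (norm (x + y))\<^sup>2 / l / 2 + (norm (x' + y'))\<^sup>2 / l / 2 \<le> s)" for y y' s
    unfolding Q_def by simp
  obtain a0 a0' where a0: "(a0, a0') \<in> gra C" using ne by auto
  obtain L where L: "linear L" and le: "\<And>z s. (z, s) \<in> Q \<Longrightarrow> L z \<le> s"
  proof (rule hahn_banach_cone[of Q])
    fix p q assume pqQ: "p \<in> Q" "q \<in> Q"
    obtain y y' s z z' t where pq: "p = ((y, y'), s)" "q = ((z, z'), t)"
      by (metis prod.collapse)
    obtain l x x' r m w w' r2 where
      1: "graph_cone (gra C) l x x' r" "r + (norm (x + y))\<^sup>2 / l / 2 + (norm (x' + y'))\<^sup>2 / l / 2 \<le> s"
      and 2: "graph_cone (gra C) m w w' r2" "r2 + (norm (w + z))\<^sup>2 / m / 2 + (norm (w' + z'))\<^sup>2 / m / 2 \<le> t"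
      using pqQ unfolding pq Q by blast
    have "(norm (x + w + (y + z)))\<^sup>2 / (l + m) \<le> (norm (x + y))\<^sup>2 / l + (norm (w + z))\<^sup>2 / m"
      using norm_sum_sq_div_le[of l m "x + y" "w + z"] graph_cone_pos[OF 1(1)] graph_cone_pos[OF 2(1)]
      by (simp add: algebra_simps)
    moreover have "(norm (x' + w' + (y' + z')))\<^sup>2 / (l + m) \<le> (norm (x' + y'))\<^sup>2 / l + (norm (w' + z'))\<^sup>2 / m"
      using norm_sum_sq_div_le[of l m "x' + y'" "w' + z'"] graph_cone_pos[OF 1(1)] graph_cone_pos[OF 2(1)]
      by (simp add: algebra_simps)
    moreover have "r + r2 + a / 2 + b / 2 \<le> s + t"
      if "a \<le> c + d" "b \<le> e + f" "r + c / 2 + e / 2 \<le> s" "r2 + d / 2 + f / 2 \<le> t"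
      for a b c d e f :: real
      using that by argo
    ultimately have "r + r2 + (norm (x + w + (y + z)))\<^sup>2 / (l + m) / 2 +
        (norm (x' + w' + (y' + z')))\<^sup>2 / (l + m) / 2 \<le> s + t"
      using 1(2) 2(2) by blast
    then have "((y + z, y' + z'), s + t) \<in> Q"
      using graph_cone.add[OF 1(1) 2(1)] unfolding Q by blast
    then show "p + q \<in> Q" using pq by simp
  next
    fix p and t :: real assume pQ: "p \<in> Q" and "0 < t"
    obtain y y' s where p: "p = ((y, y'), s)"
      by (metis prod.collapse)
    obtain l x x' r where
      1: "graph_cone (gra C) l x x' r" "r + (norm (x + y))\<^sup>2 / l / 2 + (norm (x' + y'))\<^sup>2 / l / 2 \<le> s"
      using pQ unfolding p Q by blast
    have "(norm (t *\<^sub>R x + t *\<^sub>R y))\<^sup>2 / (t * l) = t * ((norm (x + y))\<^sup>2 / l)"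
      "(norm (t *\<^sub>R x' + t *\<^sub>R y'))\<^sup>2 / (t * l) = t * ((norm (x' + y'))\<^sup>2 / l)"
      using \<open>0 < t\<close> by (simp_all flip: scaleR_add_right) (simp_all add: power2_eq_square)
    moreover have "t * (r + (norm (x + y))\<^sup>2 / l / 2 + (norm (x' + y'))\<^sup>2 / l / 2) \<le> t * s"
      using 1(2) \<open>0 < t\<close> by simp
    ultimately have "t * r + (norm (t *\<^sub>R x + t *\<^sub>R y))\<^sup>2 / (t * l) / 2 +
        (norm (t *\<^sub>R x' + t *\<^sub>R y'))\<^sup>2 / (t * l) / 2 \<le> t * s"
      by (simp add: distrib_left)
    then have "((t *\<^sub>R y, t *\<^sub>R y'), t * s) \<in> Q"
      using graph_cone_scale[OF 1(1) \<open>0 < t\<close>] unfolding Q by blast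
    then show "t *\<^sub>R p \<in> Q" using p by simp
  next
    fix z :: "'a \<times> 'a dual"
    obtain y y' where "z = (y, y')" by fastforce
    then show "\<exists>s. (z, s) \<in> Q"
      using graph_cone_base[OF a0] unfolding \<open>z = _\<close> Q by blast
  next
    fix s assume "(0, s) \<in> Q"
    then obtain l x x' r where
      1: "graph_cone (gra C) l x x' r" "r + (norm x)\<^sup>2 / l / 2 + (norm x')\<^sup>2 / l / 2 \<le> s"
      unfolding zero_prod_def Q by auto
    have l: "0 < l" using graph_cone_pos[OF 1(1)] .
    have "- (norm x' * norm x) \<le> blinfun_apply x' x"
      using norm_blinfun[of x' x] by simp
    moreover have "2 * (norm x' * norm x) \<le> (norm x)\<^sup>2 + (norm x')\<^sup>2"
      using sum_squares_bound[of "norm x'" "norm x"] by simp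
    ultimately have "0 \<le> l * r + ((norm x)\<^sup>2 + (norm x')\<^sup>2) / 2"
      using graph_cone_pairing_le[OF mono 1(1)] by argo
    also have "\<dots> = l * (r + (norm x)\<^sup>2 / l / 2 + (norm x')\<^sup>2 / l / 2)"
      using l by (simp add: field_simps)
    also have "\<dots> \<le> l * s"
      using 1(2) l by simp
    finally show "0 \<le> s" using l by (simp add: zero_le_mult_iff)
  qed blast
  have bound: "L (y, y') \<le> blinfun_apply a' a + (norm (a + y))\<^sup>2 / 2 + (norm (a' + y'))\<^sup>2 / 2"
    if "(a, a') \<in> gra C" for a a' y y'
    using graph_cone_base[OF that] by (intro le) (auto simp: Q intro!: exI)
  have bl: "bounded_linear L"
  proof (rule linear_bounded_above_on_ball[OF L])
    fix z :: "'a \<times> 'a dual"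
    assume z: "norm z \<le> 1"
    obtain y y' where yz: "z = (y, y')" by fastforce
    have "norm y \<le> 1" "norm y' \<le> 1"
      using z norm_fst_le[of y y'] norm_snd_le[of y' y] unfolding yz by linarith+
    then have "norm (a0 + y) \<le> norm a0 + 1" "norm (a0' + y') \<le> norm a0' + 1"
      using norm_triangle_ineq[of a0 y] norm_triangle_ineq[of a0' y'] by linarith+
    then have "(norm (a0 + y))\<^sup>2 \<le> (norm a0 + 1)\<^sup>2" "(norm (a0' + y'))\<^sup>2 \<le> (norm a0' + 1)\<^sup>2"
      by (intro power_mono; simp)+
    then show "L z \<le> blinfun_apply a0' a0 + (norm a0 + 1)\<^sup>2 / 2 + (norm a0' + 1)\<^sup>2 / 2"
      using bound[OF a0, of y y'] unfolding yz by argo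
  qed
  have blv: "bounded_linear (\<lambda>y. - L (y, 0))" and blu: "bounded_linear (\<lambda>y'. - L (0, y'))"
    by (intro bounded_linear_minus bounded_linear_compose[OF bl] bounded_linear_Pair
        bounded_linear_ident bounded_linear_zero)+
  define v where "v = Blinfun (\<lambda>y. - L (y, 0))"
  define u where "u = Blinfun (\<lambda>y'. - L (0, y'))"
  have v: "blinfun_apply v y = - L (y, 0)" for y
    unfolding v_def by (simp add: bounded_linear_Blinfun_apply[OF blv])
  have u: "blinfun_apply u y' = - L (0, y')" for y'
    unfolding u_def by (simp add: bounded_linear_Blinfun_apply[OF blu])
  have Lvu: "L (y, y') = - blinfun_apply v y - blinfun_apply u y'" for y y'
    using linear_add[OF L, of "(y, 0)" "(0, y')"] by (simp add: v u)
  show ?thesis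
  proof (rule that)
    fix a a' assume a: "(a, a') \<in> gra C"
    define M where "M = blinfun_apply a' a - blinfun_apply v a - blinfun_apply u a'"
    \<comment> \<open>The arguments \<open>- a - y\<close> and \<open>- a' - y'\<close> reduce the
      norms to those of \<open>y\<close> and \<open>y'\<close>, which then vary independently, so
      the two conjugates can be taken in turn.\<close>
    have M: "(blinfun_apply v y - (norm y)\<^sup>2 / 2) + (blinfun_apply u y' - (norm y')\<^sup>2 / 2) \<le> M" for y y'
      using bound[OF a, of "- a - y" "- a' - y'"] unfolding Lvu M_def
      by (simp add: blinfun.bilinear_simps)
    have "(norm v)\<^sup>2 / 2 \<le> M - (blinfun_apply u y' - (norm y')\<^sup>2 / 2)" for y'
      using M[of _ y'] by (intro norm_le_of_affine_minorant) (simp add: algebra_simps)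
    then have "(norm u)\<^sup>2 / 2 \<le> M - (norm v)\<^sup>2 / 2"
      by (intro norm_le_of_affine_minorant) (simp add: algebra_simps)
    then show "blinfun_apply v a + blinfun_apply u a' + ((norm u)\<^sup>2 + (norm v)\<^sup>2) / 2 \<le> blinfun_apply a' a"
      unfolding M_def by argo
  qed
qed

text \<open>The pair \<open>(u, v)\<close> of the minorant is monotonically related to the graph, so
  it is a graph point; the minorant evaluated there forces equality. Equality says that
  \<open>- v\<close> is a duality vector of \<open>x\<close>.\<close>

lemma ultramaximally_monotone_negative_duality_point:
  assumes C: "ultramaximally_monotone C"
  obtains x v where "(x, v) \<in> gra C"
    "blinfun_apply v x = - ((norm (canonical_embedding x))\<^sup>2 + (norm v)\<^sup>2) / 2"
proof -
  have mono: "monotone_op C" using C unfolding ultramaximally_monotone_def by blast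
  obtain u v where uv: "\<And>a a'. (a, a') \<in> gra C \<Longrightarrow>
      blinfun_apply v a + blinfun_apply u a' + ((norm u)\<^sup>2 + (norm v)\<^sup>2) / 2 \<le> blinfun_apply a' a"
    by (rule quadratic_minorant[OF mono ultramaximally_monotone_gra_nonempty[OF C]]) blast
  have "- blinfun_apply u v \<le> norm u * norm v"
    using norm_blinfun[of u v] by simp
  then have uv0: "0 \<le> blinfun_apply u v + ((norm u)\<^sup>2 + (norm v)\<^sup>2) / 2"
    using sum_squares_bound[of "norm u" "norm v"] by argo
  have "0 \<le> blinfun_apply (u - canonical_embedding a) (v - a')" if "(a, a') \<in> gra C" for a a'
    using uv[OF that] uv0 by (simp add: blinfun.bilinear_simps)
  then obtain x where x: "u = canonical_embedding x" "(x, v) \<in> gra C"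
    using C unfolding ultramaximally_monotone_def by blast
  then have "blinfun_apply v x = - ((norm (canonical_embedding x))\<^sup>2 + (norm v)\<^sup>2) / 2"
    using uv[OF x(2)] uv0 unfolding x(1) canonical_embedding_apply by argo
  then show ?thesis using that x by blast
qed

section \<open>Translation and scaling of the values\<close>

definition op_affine :: "real \<Rightarrow> 'a::real_normed_vector dual \<Rightarrow> 'a setop \<Rightarrow> 'a setop" where
  "op_affine t w C = (\<lambda>x. (\<lambda>y. t *\<^sub>R (y - w)) ` C x)"

lemma gra_op_affine: "gra (op_affine t w C) = (\<lambda>(x, y). (x, t *\<^sub>R (y - w))) ` gra C"
  unfolding gra_def op_affine_def by auto

lemma ultramaximally_monotone_op_affine:
  assumes C: "ultramaximally_monotone C" and t: "0 < t"
  shows "ultramaximally_monotone (op_affine t w C)"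
proof -
  have "0 \<le> blinfun_apply (t *\<^sub>R (y - w) - t *\<^sub>R (z - w)) (a - b)"
    if "(a, y) \<in> gra C" "(b, z) \<in> gra C" for a b y z
  proof -
    have "0 \<le> blinfun_apply (y - z) (a - b)"
      using C that unfolding ultramaximally_monotone_def monotone_op_def by blast
    then have "0 \<le> t * blinfun_apply (y - z) (a - b)"
      using t by simp
    then show ?thesis by (simp add: blinfun.bilinear_simps algebra_simps)
  qed
  then have "monotone_op (op_affine t w C)"
    unfolding monotone_op_def gra_op_affine by fastforce
  moreover have "\<exists>x. x'' = canonical_embedding x \<and> (x, x') \<in> gra (op_affine t w C)"
    if rel: "\<forall>(a, a') \<in> gra (op_affine t w C).
      0 \<le> blinfun_apply (x'' - canonical_embedding a) (x' - a')" for x'' x'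
  proof -
    define y where "y = inverse t *\<^sub>R x' + w"
    have "0 \<le> blinfun_apply (x'' - canonical_embedding a) (y - a')" if "(a, a') \<in> gra C" for a a'
    proof -
      have "(a, t *\<^sub>R (a' - w)) \<in> gra (op_affine t w C)"
        using that unfolding gra_op_affine by force
      then have "0 \<le> blinfun_apply (x'' - canonical_embedding a) (x' - t *\<^sub>R (a' - w))"
        using rel by blast
      then have "0 \<le> inverse t * blinfun_apply (x'' - canonical_embedding a) (x' - t *\<^sub>R (a' - w))"
        using t by simp
      also have "\<dots> = blinfun_apply (x'' - canonical_embedding a) (inverse t *\<^sub>R (x' - t *\<^sub>R (a' - w)))"
        by (simp add: blinfun.scaleR_right)
      also have "inverse t *\<^sub>R (x' - t *\<^sub>R (a' - w)) = y - a'"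
        using t by (simp add: y_def scaleR_diff_right)
      finally show ?thesis .
    qed
    then obtain x where x: "x'' = canonical_embedding x" "(x, y) \<in> gra C"
      using C unfolding ultramaximally_monotone_def by blast
    moreover have "x' = t *\<^sub>R (y - w)" using t by (simp add: y_def)
    ultimately show ?thesis unfolding gra_op_affine by force
  qed
  ultimately show ?thesis unfolding ultramaximally_monotone_def by blast
qed

section \<open>The closure of the range\<close>

text \<open>The projection onto the dual of the domain of the Fitzpatrick function.\<close>

definition fitzpatrick_ran :: "'a::real_normed_vector setop \<Rightarrow> 'a dual set" where
  "fitzpatrick_ran C = {w. \<exists>z M. \<forall>(a, a') \<in> gra C.
    blinfun_apply a' z + blinfun_apply w a - blinfun_apply a' a \<le> M}"

text \<open>With \<open>d = y - w\<close>, the duality point gives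
  \<open>t * (norm d)^2 \<le> - 2 * d x\<close>, and the Fitzpatrick bound at \<open>z\<close> gives
  \<open>- d x \<le> K + norm d * norm z\<close>. A large \<open>t\<close> therefore forces
  \<open>d\<close> to be small.\<close>

lemma fitzpatrick_ran_subset_closure_ran:
  assumes C: "ultramaximally_monotone C"
  shows "fitzpatrick_ran C \<subseteq> closure (op_ran C)"
proof
  fix w assume "w \<in> fitzpatrick_ran C"
  then obtain z M where zM: "\<And>a a'. (a, a') \<in> gra C \<Longrightarrow>
      blinfun_apply a' z + blinfun_apply w a - blinfun_apply a' a \<le> M"
    unfolding fitzpatrick_ran_def by blast
  define K where "K = \<bar>M - blinfun_apply w z\<bar>"
  have "\<exists>y\<in>op_ran C. dist y w < \<eta>" if \<eta>: "0 < \<eta>" for \<eta>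
  proof -
    \<comment> \<open>If \<open>norm d\<close> were at least \<open>\<eta>\<close>, then
      \<open>K \<le> K / \<eta> * norm d\<close>, and the upper bound on
      \<open>t * (norm d)^2\<close> would be below \<open>2 * S * norm d\<close>; \<open>t\<close>
      is chosen to contradict this. The summand 1 makes the inequality strict.\<close>
    define S where "S = K / \<eta> + norm z + 1"
    define t where "t = 2 * S / \<eta>"
    have S: "0 < S" using \<eta> by (simp add: S_def K_def add_nonneg_pos)
    then have t: "0 < t" using \<eta> by (simp add: t_def)
    obtain x v where xv: "(x, v) \<in> gra (op_affine t w C)"
      "blinfun_apply v x = - ((norm (canonical_embedding x))\<^sup>2 + (norm v)\<^sup>2) / 2"
      by (rule ultramaximally_monotone_negative_duality_point[OF ultramaximally_monotone_op_affine[OF C t]])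
    then obtain y where y: "(x, y) \<in> gra C" "v = t *\<^sub>R (y - w)"
      unfolding gra_op_affine by auto
    define d where "d = y - w"
    have "(norm v)\<^sup>2 \<le> 2 * - blinfun_apply v x"
      using xv(2) zero_le_power2[of "norm (canonical_embedding x)"] by argo
    then have "t * (t * (norm d)\<^sup>2) \<le> t * (2 * - blinfun_apply d x)"
      using y(2) t by (simp add: d_def blinfun.scaleR_left power2_eq_square mult.assoc mult.left_commute)
    then have 1: "t * (norm d)\<^sup>2 \<le> 2 * - blinfun_apply d x"
      using t by (rule mult_left_le_imp_le)
    have "blinfun_apply y z - blinfun_apply d x \<le> M"
      using zM[OF y(1)] by (simp add: d_def blinfun.bilinear_simps)
    then have "- blinfun_apply d x \<le> K - blinfun_apply d z"
      by (simp add: d_def K_def blinfun.bilinear_simps)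
    also have "\<dots> \<le> K + norm d * norm z"
      using norm_blinfun[of d z] by simp
    finally have 2: "t * (norm d)\<^sup>2 \<le> 2 * (K + norm d * norm z)"
      using 1 by simp
    have "norm d < \<eta>"
    proof (rule ccontr)
      assume "\<not> norm d < \<eta>"
      then have d: "\<eta> \<le> norm d" by simp
      have "K = K / \<eta> * \<eta>" using \<eta> by simp
      also have "\<dots> \<le> K / \<eta> * norm d"
        using d \<eta> by (intro mult_left_mono) (simp_all add: K_def)
      finally have "2 * (K + norm d * norm z) \<le> 2 * (K / \<eta> * norm d + norm d * norm z)"
        by (intro mult_left_mono add_right_mono) auto
      with 2 have "t * (norm d)\<^sup>2 \<le> 2 * (K / \<eta> * norm d + norm d * norm z)"
        by (rule order_trans)
      also have "\<dots> = norm d * (2 * (K / \<eta> + norm z))"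
        by (simp add: algebra_simps)
      also have "\<dots> < norm d * (2 * S)"
        using d \<eta> by (intro mult_strict_left_mono) (auto simp: S_def)
      also have "\<dots> = t * (norm d * \<eta>)"
        using \<eta> by (simp add: t_def)
      also have "\<dots> \<le> t * (norm d)\<^sup>2"
        using d t by (simp add: power2_eq_square mult_left_mono)
      finally show False by simp
    qed
    moreover have "y \<in> op_ran C"
      using y(1) unfolding gra_def op_ran_def by blast
    ultimately show ?thesis by (auto simp: d_def dist_norm)
  qed
  then show "w \<in> closure (op_ran C)"
    unfolding closure_approachable by blast
qed


section \<open>The interior of the range\<close>

text \<open>Baire's theorem yields a ball in some \<open>S n\<close>, perhaps away from
  \<open>0\<close>. A point \<open>- t *\<^sub>R v\<close> opposite its centre lies in some
  \<open>S m\<close>, and convex combinations bring the ball to \<open>0\<close>.\<close>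

lemma closed_convex_cover_contains_cball:
  fixes S :: "nat \<Rightarrow> 'v::banach set"
  assumes closed: "\<And>n. closed (S n)" and convex: "\<And>n. convex (S n)"
    and mono: "\<And>m n. m \<le> n \<Longrightarrow> S m \<subseteq> S n" and cover: "0 \<in> interior (\<Union>n. S n)"
  obtains n \<rho> where "0 < \<rho>" "cball 0 \<rho> \<subseteq> S n"
proof -
  have "\<exists>n. interior (S n) \<noteq> {}"
  proof (rule ccontr)
    assume "\<nexists>n. interior (S n) \<noteq> {}"
    then have "euclidean interior_of \<Union>(range S) = {}"
      using closed by (intro Baire_category_alt disjI1 completely_metrizable_space_euclidean) auto
    then show False using cover by simp
  qed
  then obtain n v e where e: "0 < e" "ball v e \<subseteq> S n"
    by (metis ex_in_conv mem_interior)
  obtain \<delta> where \<delta>: "0 < \<delta>" "ball 0 \<delta> \<subseteq> (\<Union>n. S n)"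
    using cover by (metis mem_interior)
  define t where "t = \<delta> / (norm v + 1) / 2"
  have t: "0 < t" using \<delta> by (simp add: t_def add_nonneg_pos)
  have "t * norm v < \<delta>"
  proof -
    have "\<delta> * norm v < \<delta> * ((norm v + 1) * 2)"
      using \<delta>(1) by (intro mult_strict_left_mono) (auto simp: add_nonneg_pos)
    then show ?thesis
      by (simp add: t_def divide_simps add_nonneg_pos add_nonneg_eq_0_iff)
  qed
  then have "- t *\<^sub>R v \<in> ball 0 \<delta>" using t by simp
  then obtain m where m: "- t *\<^sub>R v \<in> S m" using \<delta> by blast
  define k where "k = max m n"
  define \<rho> where "\<rho> = t * e / (1 + t) / 2"
  show ?thesis
  proof (rule that)
    show "0 < \<rho>" using t e by (simp add: \<rho>_def)
    show "cball 0 \<rho> \<subseteq> S k"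
    proof
      fix y :: 'v assume "y \<in> cball 0 \<rho>"
      \<comment> \<open>Solves \<open>y = (1 / (1 + t)) *\<^sub>R (- t *\<^sub>R v) + (t / (1 + t))
        *\<^sub>R x\<close>; the size of \<open>\<rho>\<close> keeps \<open>x\<close> in the ball
        about \<open>v\<close>.\<close>
      define x where "x = v + ((1 + t) / t) *\<^sub>R y"
      have "t * e / (1 + t) = 2 * \<rho>" using t by (simp add: \<rho>_def field_simps)
      then have "norm y < t * e / (1 + t)"
        using \<open>y \<in> cball 0 \<rho>\<close> \<open>0 < \<rho>\<close> by simp
      then have "(1 + t) / t * norm y < e"
        using t by (simp add: field_simps)
      then have "x \<in> S n"
        using e t unfolding x_def by (intro subsetD[OF e(2)]) (simp add: dist_norm)
      then have "(1 / (1 + t)) *\<^sub>R (- t *\<^sub>R v) + (t / (1 + t)) *\<^sub>R x \<in> S k"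
        using m t mono[of m k] mono[of n k]
        by (intro convexD[OF convex]) (auto simp: k_def field_simps)
      also have "(1 / (1 + t)) *\<^sub>R (- t *\<^sub>R v) + (t / (1 + t)) *\<^sub>R x = y"
        using t by (simp add: x_def scaleR_add_right)
      finally show "y \<in> S k" .
    qed
  qed
qed

lemma zero_in_interior_fitzpatrick_ran:
  fixes C :: "'a::real_normed_vector setop"
  assumes C: "ultramaximally_monotone C" and int: "0 \<in> interior (fitzpatrick_ran C)"
  shows "0 \<in> op_ran C"
proof -
  have mono: "monotone_op C" using C unfolding ultramaximally_monotone_def by blast
  obtain a0 a0' where a0: "(a0, a0') \<in> gra C"
    using ultramaximally_monotone_gra_nonempty[OF C] by auto
  \<comment> \<open>One number \<open>n\<close> bounds both \<open>M\<close> and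
    \<open>norm z\<close> in the Fitzpatrick inequality. Eliminating \<open>z\<close> leaves an
    intersection of closed half-spaces that increases with \<open>n\<close>, as Baire's theorem
    requires.\<close>
  define S where "S n = {v. \<forall>l x x' r. graph_cone (gra C) l x x' r \<longrightarrow>
    blinfun_apply v x \<le> r + real n * (l + norm x')}" for n
  have "fitzpatrick_ran C \<subseteq> (\<Union>n. S n)"
  proof
    fix v assume "v \<in> fitzpatrick_ran C"
    then obtain z M where zM: "\<And>a a'. (a, a') \<in> gra C \<Longrightarrow>
        blinfun_apply a' z + blinfun_apply v a - blinfun_apply a' a \<le> M"
      unfolding fitzpatrick_ran_def by blast
    obtain n where n: "max M (norm z) \<le> real n" using real_arch_simple by blast
    have "blinfun_apply v x \<le> r + l * M - blinfun_apply x' z" if "graph_cone (gra C) l x x' r" for l x x' r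
      using that
    proof (induction rule: graph_cone.induct)
      case (gen a a' t)
      then have "t * (blinfun_apply a' z + blinfun_apply v a - blinfun_apply a' a) \<le> t * M"
        using zM by (intro mult_left_mono) auto
      then show ?case by (simp add: blinfun.bilinear_simps algebra_simps)
    next
      case (add l x x' r m y y' s)
      then show ?case by (simp add: blinfun.bilinear_simps algebra_simps)
    qed
    moreover have "l * M - blinfun_apply x' z \<le> real n * (l + norm x')"
      if "graph_cone (gra C) l x x' r" for l x x' r
    proof -
      have "l * M \<le> l * real n"
        using n graph_cone_pos[OF that] by (intro mult_left_mono) auto
      moreover have "- blinfun_apply x' z \<le> norm x' * norm z"
        using norm_blinfun[of x' z] by simp
      moreover have "norm x' * norm z \<le> norm x' * real n"
        using n by (intro mult_left_mono) auto
      ultimately show ?thesis by (simp add: algebra_simps)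
    qed
    ultimately have "v \<in> S n" unfolding S_def by fastforce
    then show "v \<in> (\<Union>n. S n)" by blast
  qed
  then have cover: "0 \<in> interior (\<Union>n. S n)" using int interior_mono by blast
  have S_eq: "S n = (\<Inter>(l, x, x', r)\<in>{(l, x, x', r). graph_cone (gra C) l x x' r}.
    {v. blinfun_apply v x \<le> r + real n * (l + norm x')})" for n
    unfolding S_def by auto
  obtain n \<rho>' where "0 < \<rho>'" "cball 0 \<rho>' \<subseteq> S n"
  proof (rule closed_convex_cover_contains_cball[OF _ _ _ cover])
    show "closed (S n)" for n
      unfolding S_eq by (intro closed_INT ballI) (auto intro!: closed_Collect_le continuous_intros)
    show "convex (S n)" for n
    proof -
      have "convex {v :: 'a dual. blinfun_apply v x \<le> b}" for x :: 'a and b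
        unfolding convex_def
        by (auto simp: blinfun.bilinear_simps real_scaleR_def intro!: convex_bound_le)
      then show ?thesis unfolding S_eq by (intro convex_INT) auto
    qed
    show "S m \<subseteq> S n" if "m \<le> n" for m n
    proof -
      have "r + real m * (l + norm x') \<le> r + real n * (l + norm x')"
        if "graph_cone (gra C) l x x' r" for l x x' r
        using \<open>m \<le> n\<close> graph_cone_pos[OF that] by (intro add_left_mono mult_right_mono) auto
      then show ?thesis unfolding S_def by fastforce
    qed
  qed blast
  moreover define \<rho> where "\<rho> = min 1 \<rho>'"
  ultimately have \<rho>: "0 < \<rho>" "\<rho> \<le> 1" "cball 0 \<rho> \<subseteq> S n" by auto
  define R where "R = real n / \<rho>"
  have R: "0 \<le> R" using \<rho> by (simp add: R_def)
  text \<open>Testing membership in \<open>S n\<close> against the multiple of \<open>- x'\<close> of norm \<open>\<rho>\<close> and combining the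
    outcome with \<open>x' x \<le> l * r\<close> eliminates the term in \<open>x\<close>.\<close>
  have lower: "- R * norm x' \<le> r" if k: "graph_cone (gra C) l x x' r" for l x x' r
  proof -
    have l: "0 < l" using graph_cone_pos[OF k] .
    have le: "blinfun_apply x' x \<le> l * r" using graph_cone_pairing_le[OF mono k] .
    show ?thesis
    proof (cases "x' = 0")
      case True
      then show ?thesis using le l by (simp add: zero_le_mult_iff)
    next
      case False
      then have nx: "0 < norm x'" by simp
      have "(- \<rho> / norm x') *\<^sub>R x' \<in> S n"
        using \<rho> nx by (intro subsetD[OF \<rho>(3)]) simp
      then have "- \<rho> / norm x' * blinfun_apply x' x \<le> r + real n * (l + norm x')"
        using k unfolding S_def by (auto simp: blinfun.bilinear_simps)
      then have "- \<rho> * blinfun_apply x' x \<le> norm x' * (r + real n * (l + norm x'))"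
        using nx by (simp add: field_simps)
      moreover have "\<rho> * blinfun_apply x' x \<le> \<rho> * (l * r)"
        using le \<rho> by simp
      ultimately have "0 \<le> (\<rho> * l + norm x') * r + norm x' * (real n * (l + norm x'))"
        by (simp add: algebra_simps)
      \<comment> \<open>The choices \<open>\<rho> \<le> 1\<close> and \<open>R = n / \<rho>\<close>
        make the right side a multiple of \<open>\<rho> * l + norm x'\<close>, the positive factor
        cancelled next.\<close>
      also have "real n * (l + norm x') \<le> R * (\<rho> * l + norm x')"
      proof -
        have "\<rho> * norm x' \<le> norm x'" using \<rho> by (intro mult_left_le_one_le) auto
        then have "R * (\<rho> * (l + norm x')) \<le> R * (\<rho> * l + norm x')"
          using R by (intro mult_left_mono) (simp_all add: distrib_left)
        then show ?thesis using \<rho> by (simp add: R_def)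
      qed
      finally have "0 \<le> (\<rho> * l + norm x') * (r + norm x' * R)"
        using nx by (simp add: algebra_simps mult_left_mono)
      moreover have "0 < \<rho> * l + norm x'" using \<rho> l nx by (simp add: add_pos_pos)
      ultimately have "0 \<le> r + norm x' * R" by (simp add: zero_le_mult_iff)
      then show ?thesis by (simp add: mult.commute)
    qed
  qed
  \<comment> \<open>Only the dual variable is displaced, so the separating functional is a single
    element of the bidual; \<open>lower\<close> supplies nonnegativity over
    \<open>0\<close>.\<close>
  define Q where "Q = {(y, s) | y s. \<exists>l x x' r. graph_cone (gra C) l x x' r \<and>
    r + R * norm (x' + y) \<le> s}"
  have Q: "(y, s) \<in> Q \<longleftrightarrow> (\<exists>l x x' r. graph_cone (gra C) l x x' r \<and> r + R * norm (x' + y) \<le> s)" for y s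
    unfolding Q_def by simp
  obtain L where L: "linear L" and le: "\<And>y s. (y, s) \<in> Q \<Longrightarrow> L y \<le> s"
  proof (rule hahn_banach_cone[of Q])
    fix p q assume pqQ: "p \<in> Q" "q \<in> Q"
    obtain y s z t where pq: "p = (y, s)" "q = (z, t)"
      by (metis prod.collapse)
    obtain l x x' r m w w' r2 where
      1: "graph_cone (gra C) l x x' r" "r + R * norm (x' + y) \<le> s"
      and 2: "graph_cone (gra C) m w w' r2" "r2 + R * norm (w' + z) \<le> t"
      using pqQ unfolding pq Q by blast
    have "R * norm (x' + w' + (y + z)) \<le> R * (norm (x' + y) + norm (w' + z))"
      using norm_triangle_ineq[of "x' + y" "w' + z"] R by (intro mult_left_mono) (simp_all add: algebra_simps)
    then have "r + r2 + R * norm (x' + w' + (y + z)) \<le> s + t"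
      using 1(2) 2(2) by (simp add: distrib_left)
    then show "p + q \<in> Q"
      using graph_cone.add[OF 1(1) 2(1)] unfolding pq add_Pair Q by blast
  next
    fix p and t :: real assume pQ: "p \<in> Q" and "0 < t"
    obtain y s where p: "p = (y, s)"
      by (metis prod.collapse)
    obtain l x x' r where 1: "graph_cone (gra C) l x x' r" "r + R * norm (x' + y) \<le> s"
      using pQ unfolding p Q by blast
    have "t * (r + R * norm (x' + y)) \<le> t * s"
      using 1(2) \<open>0 < t\<close> by simp
    then have "t * r + R * norm (t *\<^sub>R x' + t *\<^sub>R y) \<le> t * s"
      using \<open>0 < t\<close> by (simp add: algebra_simps flip: scaleR_add_right)
    then have "(t *\<^sub>R y, t * s) \<in> Q"
      using graph_cone_scale[OF 1(1) \<open>0 < t\<close>] unfolding Q by blast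
    then show "t *\<^sub>R p \<in> Q" using p by simp
  next
    show "\<exists>s. (y, s) \<in> Q" for y
      using graph_cone_base[OF a0] unfolding Q by blast
  next
    show "0 \<le> s" if "(0, s) \<in> Q" for s
      using that lower unfolding Q by fastforce
  qed blast
  have bound: "L y \<le> blinfun_apply a' a + R * norm (a' + y)" if "(a, a') \<in> gra C" for a a' y
    using graph_cone_base[OF that] by (intro le) (auto simp: Q intro!: exI)
  have bl: "bounded_linear L"
  proof (rule linear_bounded_above_on_ball[OF L])
    fix y :: "'a dual"
    assume "norm y \<le> 1"
    then have "R * norm (a0' + y) \<le> R * (norm a0' + 1)"
      using R norm_triangle_ineq[of a0' y] by (intro mult_left_mono) auto
    then show "L y \<le> blinfun_apply a0' a0 + R * (norm a0' + 1)"
      using bound[OF a0, of y] by linarith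
  qed
  define u where "u = Blinfun (\<lambda>y. - L y)"
  have u: "blinfun_apply u y = - L y" for y
    unfolding u_def by (simp add: bounded_linear_Blinfun_apply bounded_linear_minus[OF bl])
  \<comment> \<open>At \<open>y = - a'\<close> the norm term vanishes and \<open>bound\<close>
    becomes \<open>u a' \<le> a' a\<close>.\<close>
  have "0 \<le> blinfun_apply (u - canonical_embedding a) (0 - a')" if "(a, a') \<in> gra C" for a a'
    using bound[OF that, of "- a'"] by (simp add: blinfun.bilinear_simps u linear_neg[OF L])
  then obtain x where "(x, 0) \<in> gra C"
    using C unfolding ultramaximally_monotone_def by blast
  then show ?thesis unfolding gra_def op_ran_def by blast
qed

text \<open>Subtracting \<open>w\<close> from the values changes the Fitzpatrick bound at
  \<open>z\<close> only by the constant \<open>w z\<close>, which reduces the claim to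
  \<open>w = 0\<close>.\<close>

lemma interior_fitzpatrick_ran_subset_ran:
  assumes C: "ultramaximally_monotone C"
  shows "interior (fitzpatrick_ran C) \<subseteq> op_ran C"
proof
  fix w assume w: "w \<in> interior (fitzpatrick_ran C)"
  define C' where "C' = op_affine 1 w C"
  have "(\<lambda>v. v - w) ` fitzpatrick_ran C \<subseteq> fitzpatrick_ran C'"
  proof safe
    fix v assume "v \<in> fitzpatrick_ran C"
    then obtain z M where zM: "\<forall>(a, a') \<in> gra C.
        blinfun_apply a' z + blinfun_apply v a - blinfun_apply a' a \<le> M"
      unfolding fitzpatrick_ran_def by blast
    have "\<forall>(a, a') \<in> gra C'.
        blinfun_apply a' z + blinfun_apply (v - w) a - blinfun_apply a' a \<le> M - blinfun_apply w z"
      using zM unfolding C'_def gra_op_affine by (auto simp: blinfun.bilinear_simps)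
    then show "v - w \<in> fitzpatrick_ran C'"
      unfolding fitzpatrick_ran_def by blast
  qed
  then have "interior ((\<lambda>v. v - w) ` fitzpatrick_ran C) \<subseteq> interior (fitzpatrick_ran C')"
    by (rule interior_mono)
  moreover have "0 \<in> interior ((\<lambda>v. v - w) ` fitzpatrick_ran C)"
    using w interior_translation_subtract[of w "fitzpatrick_ran C"] by force
  ultimately have "0 \<in> op_ran C'"
    using zero_in_interior_fitzpatrick_ran ultramaximally_monotone_op_affine[OF C, of 1 w]
    unfolding C'_def by auto
  then show "w \<in> op_ran C"
    unfolding C'_def op_affine_def op_ran_def by auto
qed

section \<open>Rectangularity and the sum of the ranges\<close>

lemma fitzpatrick_dom_bound:
  assumes "(x, x') \<in> fitzpatrick_dom A"
  obtains M where "\<And>a a'. (a, a') \<in> gra A \<Longrightarrow>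
    blinfun_apply a' x + blinfun_apply x' a - blinfun_apply a' a \<le> M"
proof -
  obtain M where M: "fitzpatrick A x x' = ereal M"
    using assms unfolding fitzpatrick_dom_def by auto
  show ?thesis
  proof (rule that)
    fix a a' assume "(a, a') \<in> gra A"
    then have "ereal (blinfun_apply a' x + blinfun_apply x' a - blinfun_apply a' a) \<le> fitzpatrick A x x'"
      unfolding fitzpatrick_def by (intro SUP_upper2) auto
    then show "blinfun_apply a' x + blinfun_apply x' a - blinfun_apply a' a \<le> M"
      unfolding M by simp
  qed
qed

text \<open>It suffices to bound the Fitzpatrick functions of \<open>A\<close> at
  \<open>(z, p)\<close> and of \<open>B\<close> at \<open>(z, q)\<close> for a common
  \<open>z\<close>, since the bounds add over a common first coordinate. Under (i), \<open>z\<close>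
  is any point of both domains; under (ii), \<open>z\<close> satisfies \<open>p \<in> A z\<close>,
  and monotonicity of \<open>A\<close> gives its bound.\<close>

lemma sum_ran_subset_fitzpatrick_ran:
  assumes mono: "monotone_op A" and dom: "op_dom A \<inter> op_dom B \<noteq> {}"
    and rect: "(rectangular A \<and> rectangular B) \<or> (op_dom A \<subseteq> op_dom B \<and> rectangular B)"
  shows "op_ran A + op_ran B \<subseteq> fitzpatrick_ran (op_sum A B)"
proof
  fix w assume "w \<in> op_ran A + op_ran B"
  then obtain p q where w: "w = p + q" and pq: "p \<in> op_ran A" "q \<in> op_ran B"
    by (auto elim: set_plus_elim)
  have "\<exists>z M N. (\<forall>(a, a')\<in>gra A. blinfun_apply a' z + blinfun_apply p a - blinfun_apply a' a \<le> M) \<and>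
      (\<forall>(a, a')\<in>gra B. blinfun_apply a' z + blinfun_apply q a - blinfun_apply a' a \<le> N)"
    using rect
  proof (elim disjE conjE)
    assume "rectangular A" "rectangular B"
    obtain z where "z \<in> op_dom A" "z \<in> op_dom B" using dom by blast
    then have "(z, p) \<in> fitzpatrick_dom A" "(z, q) \<in> fitzpatrick_dom B"
      using pq \<open>rectangular A\<close> \<open>rectangular B\<close> unfolding rectangular_def by auto
    then show ?thesis
      by (elim fitzpatrick_dom_bound) blast
  next
    assume sub: "op_dom A \<subseteq> op_dom B" and "rectangular B"
    obtain z where z: "(z, p) \<in> gra A" using pq unfolding op_ran_def gra_def by blast
    then have "z \<in> op_dom B" using sub unfolding gra_def op_dom_def by blast
    then have "(z, q) \<in> fitzpatrick_dom B"
      using pq \<open>rectangular B\<close> unfolding rectangular_def by auto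
    moreover have "blinfun_apply a' z + blinfun_apply p a - blinfun_apply a' a \<le> blinfun_apply p z"
      if "(a, a') \<in> gra A" for a a'
    proof -
      have "0 \<le> blinfun_apply (p - a') (z - a)"
        using mono z that unfolding monotone_op_def by blast
      then show ?thesis by (simp add: blinfun.bilinear_simps)
    qed
    ultimately show ?thesis
      by (elim fitzpatrick_dom_bound) blast
  qed
  then obtain z M N where
    M: "\<And>a a'. (a, a') \<in> gra A \<Longrightarrow> blinfun_apply a' z + blinfun_apply p a - blinfun_apply a' a \<le> M"
    and N: "\<And>a a'. (a, a') \<in> gra B \<Longrightarrow> blinfun_apply a' z + blinfun_apply q a - blinfun_apply a' a \<le> N"
    by blast
  have "blinfun_apply c z + blinfun_apply w a - blinfun_apply c a \<le> M + N"
    if c: "(a, c) \<in> gra (op_sum A B)" for a c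
  proof -
    obtain a' b' where "c = a' + b'" "(a, a') \<in> gra A" "(a, b') \<in> gra B"
      using c unfolding gra_def op_sum_def by blast
    then show ?thesis
      using M[of a a'] N[of a b'] by (simp add: w blinfun.bilinear_simps)
  qed
  then show "w \<in> fitzpatrick_ran (op_sum A B)"
    unfolding fitzpatrick_ran_def by blast
qed

theorem theorem3p9:
  fixes A B :: "'a::banach \<Rightarrow> ('a \<Rightarrow>\<^sub>L real) set"
  assumes "monotone_op A" and "monotone_op B"
    and "op_dom A \<inter> op_dom B \<noteq> {}"
    and "ultramaximally_monotone (op_sum A B)"
    and "(rectangular A \<and> rectangular B) \<or> (op_dom A \<subseteq> op_dom B \<and> rectangular B)"
  shows "interior (op_ran (op_sum A B)) = interior (op_ran A + op_ran B)
    \<and> closure (op_ran A + op_ran B) = closure (op_ran (op_sum A B))"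
proof -
  let ?C = "op_sum A B"
  have sub: "op_ran A + op_ran B \<subseteq> fitzpatrick_ran ?C"
    using sum_ran_subset_fitzpatrick_ran assms by blast
  have "op_ran ?C \<subseteq> op_ran A + op_ran B"
    unfolding op_ran_def op_sum_def by (fastforce intro: set_plus_intro)
  moreover have "interior (op_ran A + op_ran B) \<subseteq> op_ran ?C"
    using interior_mono[OF sub] interior_fitzpatrick_ran_subset_ran[OF assms(4)] by blast
  moreover have "op_ran A + op_ran B \<subseteq> closure (op_ran ?C)"
    using sub fitzpatrick_ran_subset_closure_ran[OF assms(4)] by blast
  ultimately show ?thesis
    by (meson closed_closure closure_minimal closure_mono interior_maximal interior_mono
        open_interior subset_antisym)
qed

end
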